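(* Let $n,k$ be integers with $n/2<k<n$, and write $n=q(n-k+1)+r$ with $q\in\mathbf{N}$ and $0\le r\le n-k$. In the knights-and-spies searching problem in which spies always lie, \[ \overline{T}_L(n,k)=\begin{cases} n-q+1 & \text{if } r=0,\\ n-q & \text{if } r\ge 1,\end{cases} \qquad \widetilde{T}_L(n,k)=\begin{cases} n-q & \text{if } r\in\{0,1\},\\ n-q-1 & \text{if } r\ge 2,\end{cases} \] with the single exception that $\widetilde{T}_L(5,3)=4$.
   Context: There are $n$ people, numbered $1,\dots,n$, each of whom is either a knight or a spy. It is known that at least $k$ of them are knights, where $n/2<k<n$. The only permitted questions have the form "Person $x$, is Person $y$ a spy?" with $x\neq y$, and each such question is answered "yes" or "no" by Person $x$. Knights always answer truthfully; in this setting spies always lie. Questions are adaptive: each question may be chosen in the light of the answers to earlier questions. A number of questions is "necessary and sufficient" for a task if there is an adaptive questioning strategy that accomplishes the task with at most that many questions for every assignment of identities consistent with the hypotheses, and no strategy using fewer questions does so. $\overline{T}_L(n,k)$ is the number of questions necessary and sufficient either to identify (with certainty) a person who is a spy, or to correctly conclude that everyone is a knight. $\widetilde{T}_L(n,k)$ is the number of questions necessary and sufficient to identify a spy when it is additionally known that at least one spy is present. *)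

theory Defs
  imports Complex_Main "HOL-Library.Extended_Nat"
begin

datatype verdict = Spy nat | All_Knights

datatype strategy =
  Verdict verdict
| Ask nat nat strategy strategy
  \<comment> \<open>\<open>Ask x y t u\<close> asks Person \<open>x\<close> whether Person \<open>y\<close> is a spy, continuing with \<open>t\<close> on
    the answer ``yes'' and with \<open>u\<close> on the answer ``no''.\<close>

text \<open>People are the numbers in \<open>{1..n}\<close>; an assignment of identities is given by its set \<open>S\<close>
  of spies.\<close>

fun legal :: "nat \<Rightarrow> strategy \<Rightarrow> bool" where
  "legal n (Verdict v) \<longleftrightarrow> True"
| "legal n (Ask x y t u) \<longleftrightarrow>
     x \<in> {1..n} \<and> y \<in> {1..n} \<and> x \<noteq> y \<and> legal n t \<and> legal n u"

definition answers_yes :: "nat set \<Rightarrow> nat \<Rightarrow> nat \<Rightarrow> bool" where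
  "answers_yes S x y \<longleftrightarrow> (if x \<in> S then \<not> (y \<in> S) else y \<in> S)"

fun outcome :: "nat set \<Rightarrow> strategy \<Rightarrow> verdict" where
  "outcome S (Verdict v) = v"
| "outcome S (Ask x y t u) = (if answers_yes S x y then outcome S t else outcome S u)"

fun questions_asked :: "nat set \<Rightarrow> strategy \<Rightarrow> nat" where
  "questions_asked S (Verdict v) = 0"
| "questions_asked S (Ask x y t u) =
     Suc (if answers_yes S x y then questions_asked S t else questions_asked S u)"

fun correct :: "nat set \<Rightarrow> verdict \<Rightarrow> bool" where
  "correct S (Spy x) \<longleftrightarrow> x \<in> S"
| "correct S All_Knights \<longleftrightarrow> S = {}"

definition identities :: "nat \<Rightarrow> nat \<Rightarrow> nat set set" where
  "identities n k = {S. S \<subseteq> {1..n} \<and> k \<le> card ({1..n} - S)}"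

definition suffices :: "nat \<Rightarrow> nat set set \<Rightarrow> nat \<Rightarrow> bool" where
  "suffices n \<S> m \<longleftrightarrow>
     (\<exists>t. legal n t \<and> (\<forall>S\<in>\<S>. correct S (outcome S t) \<and> questions_asked S t \<le> m))"

text \<open>The infimum is taken in \<^typ>\<open>enat\<close>, so that its being finite entails that some strategy
  accomplishes the task.\<close>

definition questions_needed :: "nat \<Rightarrow> nat set set \<Rightarrow> enat" where
  "questions_needed n \<S> = Inf {enat m |m. suffices n \<S> m}"

definition T_bar :: "nat \<Rightarrow> nat \<Rightarrow> enat" where
  "T_bar n k = questions_needed n (identities n k)"

text \<open>Once a spy is known to be present, the verdict \<^const>\<open>All_Knights\<close> is never correct, so a
  spy has to be named.\<close>

definition T_tilde :: "nat \<Rightarrow> nat \<Rightarrow> enat" where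
  "T_tilde n k = questions_needed n {S \<in> identities n k. S \<noteq> {}}"

end

theory Submission
  imports Defs
begin

text \<open>Whoever is asked, the answer is ``yes'' iff the two people are of different kinds. With
  \<open>s = n - k\<close>, more than \<open>s\<close> people of one kind are therefore knights.

  Upper bounds: compare Person 1 with \<open>s\<close> others. If a difference shows up, continue until
  \<open>2 s + 1\<close> people are compared and take a majority; otherwise Person 1 is a knight, and the
  remaining people are tested in blocks of \<open>s + 1\<close>, each block costing only \<open>s\<close> questions, as a
  block of equals consists of knights. Where it pays, one person is left out and blamed by
  elimination. Only \<open>n = 2 s + 1\<close> with a spy present needs a different strategy.

  Lower bounds: while all answers are ``no'', \<open>m\<close> questions leave at least \<open>n - m\<close> classes, and
  each class of at most \<open>s\<close> people could be the set of all spies. In the boundary cases the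
  adversary answers ``yes'' to the last question, merging two such classes; either may then be the
  set of spies.\<close>

lemma answers_yes_iff: "answers_yes S x y \<longleftrightarrow> (x \<in> S \<longleftrightarrow> y \<notin> S)"
  by (auto simp: answers_yes_def)

section \<open>Composing strategies\<close>

lemma suffices_mono:
  assumes "suffices n F m" "F' \<subseteq> F" "m \<le> m'"
  shows "suffices n F' m'"
  using assms unfolding suffices_def by (meson le_trans subsetD)

lemma suffices_verdict:
  assumes "\<And>S. S \<in> F \<Longrightarrow> correct S v"
  shows "suffices n F m"
  unfolding suffices_def by (rule exI[of _ "Verdict v"]) (use assms in auto)

lemma suffices_Spy: "(\<And>S. S \<in> F \<Longrightarrow> x \<in> S) \<Longrightarrow> suffices n F m"
  by (rule suffices_verdict[where v = "Spy x"]) auto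

lemma suffices_All_Knights: "(\<And>S. S \<in> F \<Longrightarrow> S = {}) \<Longrightarrow> suffices n F m"
  by (rule suffices_verdict[where v = All_Knights]) auto

lemma suffices_ask:
  assumes "x \<in> {1..n}" "y \<in> {1..n}" "x \<noteq> y"
    and "suffices n {S \<in> F. answers_yes S x y} m" "suffices n {S \<in> F. \<not> answers_yes S x y} m"
  shows "suffices n F (Suc m)"
proof -
  obtain t u where
    "legal n t" "\<forall>S\<in>{S \<in> F. answers_yes S x y}. correct S (outcome S t) \<and> questions_asked S t \<le> m"
    "legal n u" "\<forall>S\<in>{S \<in> F. \<not> answers_yes S x y}. correct S (outcome S u) \<and> questions_asked S u \<le> m"
    using assms unfolding suffices_def by blast
  then show ?thesis
    unfolding suffices_def using assms by (intro exI[of _ "Ask x y t u"]) auto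
qed

text \<open>A batch of questions fixed in advance: the continuation depends only on the set
  \<open>D\<close> of those of whom \<open>x\<close> said "yes".\<close>

lemma suffices_probe:
  assumes "finite Y" "x \<in> {1..n}" "Y \<subseteq> {1..n} - {x}"
    and "\<And>D. D \<subseteq> Y \<Longrightarrow> suffices n {S \<in> F. {y \<in> Y. answers_yes S x y} = D} m"
  shows "suffices n F (m + card Y)"
  using assms
proof (induction Y arbitrary: F rule: finite_induct)
  case empty
  then have "suffices n {S \<in> F. {y \<in> {}. answers_yes S x y} = {}} m" by blast
  then show ?case by simp
next
  case (insert y Y)
  have "suffices n F (Suc (m + card Y))"
  proof (rule suffices_ask[of x _ y])
    show "suffices n {S \<in> F. answers_yes S x y} (m + card Y)"
    proof (rule insert.IH)
      fix D assume D: "D \<subseteq> Y"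
      show "suffices n {S \<in> {S \<in> F. answers_yes S x y}. {y \<in> Y. answers_yes S x y} = D} m"
        by (rule suffices_mono[OF insert.prems(3)[of "insert y D"]]) (use D in auto)
    qed (use insert.prems in auto)
    show "suffices n {S \<in> F. \<not> answers_yes S x y} (m + card Y)"
    proof (rule insert.IH)
      fix D assume D: "D \<subseteq> Y"
      show "suffices n {S \<in> {S \<in> F. \<not> answers_yes S x y}. {y \<in> Y. answers_yes S x y} = D} m"
        by (rule suffices_mono[OF insert.prems(3)[of D]]) (use D in auto)
    qed (use insert.prems in auto)
  qed (use insert in auto)
  then show ?case using insert.hyps by simp
qed

section \<open>Upper bounds\<close>

text \<open>Person \<open>z\<close> is a known knight; the last hypothesis is what remains to be done once everyone
  in \<open>U\<close> is known to be a knight.\<close>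

lemma suffices_blocks:
  assumes "\<And>S. S \<in> F \<Longrightarrow> finite S \<and> card S \<le> s \<and> z \<notin> S"
    and "U \<subseteq> {1..n} - {z}" "z \<in> {1..n}" "card U = j * (s + 1) + r" "1 \<le> r"
    and "suffices n {S \<in> F. S \<inter> U = {}} m"
  shows "suffices n F (j * s + r + m)"
  using assms
proof (induction j arbitrary: F U)
  case 0
  have fU: "finite U" using 0(2) finite_subset by blast
  have "suffices n F (m + card U)"
  proof (rule suffices_probe[of _ z])
    fix D assume D: "D \<subseteq> U"
    show "suffices n {S \<in> F. {y \<in> U. answers_yes S z y} = D} m"
    proof (cases "D = {}")
      case True
      then show ?thesis
        by (intro suffices_mono[OF 0(6)]) (use 0(1) in \<open>auto simp: answers_yes_iff\<close>)
    next
      case False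
      then obtain d where "d \<in> D" by auto
      then show ?thesis
        by (intro suffices_Spy[of _ d]) (use 0(1) in \<open>auto simp: answers_yes_iff\<close>)
    qed
  qed (use 0 fU in auto)
  then show ?case using 0 by (simp add: add.commute)
next
  case (Suc j)
  have fU: "finite U" using Suc.prems(2) finite_subset by blast
  obtain G where G: "G \<subseteq> U" "card G = s + 1"
    using obtain_subset_with_card_n[of "s + 1" U] Suc.prems(4) by auto
  then obtain g where g: "g \<in> G" by fastforce
  have fG: "finite G" using G fU finite_subset by blast
  let ?Y = "G - {g}"
  have cY: "card ?Y = s" using G g fG by simp
  \<comment> \<open>The questions go through a member \<open>g\<close> of the block rather than
    through the knight \<open>z\<close>: if no difference shows up, \<open>s\<close> questions
    settle \<open>s + 1\<close> people.\<close>
  have "suffices n F ((j * s + r + m) + card ?Y)"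
  proof (rule suffices_probe[of _ g])
    fix D assume D: "D \<subseteq> ?Y"
    let ?F = "{S \<in> F. {y \<in> ?Y. answers_yes S g y} = D}"
    show "suffices n ?F (j * s + r + m)"
    proof (cases "D = {}")
      case True
      have disj: "S \<inter> G = {}" if S: "S \<in> ?F" for S
      proof (rule ccontr)
        assume "S \<inter> G \<noteq> {}"
        then have "G \<subseteq> S" using S True by (auto simp: answers_yes_iff)
        then have "card G \<le> card S" using S Suc.prems(1) by (auto intro: card_mono)
        then show False using S G Suc.prems(1)[of S] by auto
      qed
      show ?thesis
      proof (rule Suc.IH[of _ "U - G"])
        show "card (U - G) = j * (s + 1) + r"
          using Suc.prems(4) G fG by (simp add: card_Diff_subset)
        show "suffices n {S \<in> ?F. S \<inter> (U - G) = {}} m"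
          by (rule suffices_mono[OF Suc.prems(6)]) (use disj in auto)
      qed (use Suc.prems in auto)
    next
      case False
      then obtain d where d: "d \<in> D" by auto
      \<comment> \<open>One of \<open>g\<close> and \<open>d\<close> is a spy, and \<open>z\<close>
        tells which. The budget has room for this question because \<open>1 \<le> r\<close>.\<close>
      have "suffices n ?F (Suc (j * s + r + m - 1))"
      proof (rule suffices_ask[of z _ g])
        show "suffices n {S \<in> ?F. answers_yes S z g} (j * s + r + m - 1)"
          by (rule suffices_Spy[of _ g]) (use Suc.prems(1) in \<open>auto simp: answers_yes_iff\<close>)
        show "suffices n {S \<in> ?F. \<not> answers_yes S z g} (j * s + r + m - 1)"
          by (rule suffices_Spy[of _ d]) (use Suc.prems(1) d in \<open>auto simp: answers_yes_iff\<close>)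
      qed (use Suc.prems g G in auto)
      then show ?thesis using Suc.prems by simp
    qed
  qed (use Suc.prems g G fG in auto)
  then show ?case using cY by (simp add: algebra_simps)
qed

text \<open>Each of the \<open>q\<close> full blocks saves one question. Person 1 becomes the knight
  \<open>z\<close> of \<open>suffices_blocks\<close> if the first block is uniform; otherwise a
  majority among \<open>2 * s + 1\<close> people exposes a spy.\<close>

lemma suffices_initial_segment:
  assumes F: "\<And>S. S \<in> F \<Longrightarrow> finite S \<and> 0 \<notin> S \<and> card S \<le> s"
    and N: "N = q * (s + 1) + r" "1 \<le> r" "1 \<le> q" "2 * s + 1 \<le> N" "N \<le> n"
    and s: "1 \<le> s"
    and rest: "suffices n {S \<in> F. S \<inter> {1..N} = {}} m"
  shows "suffices n F (N - q + m)"
proof -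
  obtain p where p: "q = Suc p" using N by (cases q) auto
  have cost: "N - q + m = (p * s + r + m) + s"
    using N p by simp
  let ?Y = "{2..s + 1}"
  have "suffices n F ((p * s + r + m) + card ?Y)"
  proof (rule suffices_probe[of _ 1])
    fix D assume D: "D \<subseteq> ?Y"
    let ?F = "{S \<in> F. {y \<in> ?Y. answers_yes S 1 y} = D}"
    show "suffices n ?F (p * s + r + m)"
    proof (cases "D = {}")
      case True
      have eq: "{1..s + 1} = insert 1 ?Y" by auto
      have disj: "S \<inter> {1..s + 1} = {}" if S: "S \<in> ?F" for S
      proof (rule ccontr)
        assume "S \<inter> {1..s + 1} \<noteq> {}"
        moreover have "\<forall>y\<in>?Y. y \<in> S \<longleftrightarrow> 1 \<in> S"
          using S True by (auto simp: answers_yes_iff)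
        ultimately have "{1..s + 1} \<subseteq> S" unfolding eq by blast
        then show False using S F[of S] card_mono[of S "{1..s + 1}"] by auto
      qed
      show ?thesis
      proof (rule suffices_blocks[of _ s 1 "{s + 2..N}"])
        show "finite S \<and> card S \<le> s \<and> 1 \<notin> S" if "S \<in> ?F" for S
          using disj[OF that] F[of S] that by auto
        show "card {s + 2..N} = p * (s + 1) + r" using N p by simp
        have "{1..N} \<subseteq> {1..s + 1} \<union> {s + 2..N}" by auto
        then show "suffices n {S \<in> ?F. S \<inter> {s + 2..N} = {}} m"
          by (intro suffices_mono[OF rest]) (use disj in blast)+
      qed (use N in auto)
    next
      case False
      then obtain d where d: "d \<in> D" by auto
      let ?Z = "{s + 2..2 * s + 1}"
      \<comment> \<open>The remaining budget covers \<open>s\<close> more comparisons: for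
        \<open>p = 0\<close>, \<open>2 * s + 1 \<le> N\<close> says that
        \<open>s \<le> r\<close>.\<close>
      have "s \<le> p * s + r"
      proof (cases p)
        case 0
        then show ?thesis using N p by simp
      qed auto
      then have le: "card ?Z \<le> p * s + r" by simp
      have "suffices n ?F (0 + card ?Z)"
      proof (rule suffices_probe[of _ 1])
        fix D' assume D': "D' \<subseteq> ?Z"
        let ?F' = "{S \<in> ?F. {y \<in> ?Z. answers_yes S 1 y} = D'}"
        \<comment> \<open>\<open>?T\<close> holds those of the first \<open>2 * s + 1\<close> people
          who differ from Person 1. Whichever of \<open>?T\<close> and its complement has at most
          \<open>s\<close> members consists of spies; \<open>d\<close> lies in the former, Person 1
          in the latter.\<close>
        let ?T = "D \<union> D'"
        have T: "?T \<subseteq> {2..2 * s + 1}" using D D' by auto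
        have fT: "finite ?T" using T finite_subset by blast
        have split: "{1..2 * s + 1} \<subseteq> {1} \<union> ?Y \<union> ?Z" by auto
        show "suffices n ?F' 0"
        proof (cases "card ?T \<le> s")
          case True
          show ?thesis
          proof (rule suffices_Spy[of _ d])
            fix S assume S: "S \<in> ?F'"
            have "1 \<notin> S"
            proof
              assume "1 \<in> S"
              then have "{1..2 * s + 1} - ?T \<subseteq> S"
                using S split by (auto simp: answers_yes_iff)
              then have "card ({1..2 * s + 1} - ?T) \<le> card S"
                using S F by (auto intro: card_mono)
              moreover have "card ({1..2 * s + 1} - ?T) = 2 * s + 1 - card ?T"
                using T fT by (subst card_Diff_subset) (auto simp: subset_iff)
              ultimately show False using S F[of S] True by auto
            qed
            then show "d \<in> S" using S d by (auto simp: answers_yes_iff)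
          qed
        next
          case False
          show ?thesis
          proof (rule suffices_Spy[of _ 1], rule ccontr)
            fix S assume S: "S \<in> ?F'" and "1 \<notin> S"
            then have "?T \<subseteq> S" by (auto simp: answers_yes_iff)
            then have "card ?T \<le> card S" using S F by (auto intro: card_mono)
            then show False using S F[of S] False by auto
          qed
        qed
      qed (use N s in auto)
      then show ?thesis by (rule suffices_mono) (use le in auto)
    qed
  qed (use N s in auto)
  then show ?thesis by (simp add: cost)
qed

text \<open>The four unions of a part from each pair fall into two complementary pairs, of which only
  the smaller member can consist of spies; the two surviving unions share a part.\<close>

lemma suffices_two_splits:
  assumes F: "\<And>S. S \<in> F \<Longrightarrow> finite S \<and> card S \<le> s \<and> (A \<subseteq> S \<or> B \<subseteq> S) \<and> (C \<subseteq> S \<or> D \<subseteq> S)"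
    and fin: "finite A" "finite B" "finite C" "finite D"
    and ne: "A \<noteq> {}" "B \<noteq> {}" "C \<noteq> {}" "D \<noteq> {}"
    and dis: "(A \<union> B) \<inter> (C \<union> D) = {}"
    and total: "card A + card B + card C + card D = 2 * s + 1"
  shows "suffices n F m"
proof -
  have bound: "card X + card Y \<le> s"
    if "S \<in> F" "X \<subseteq> S" "Y \<subseteq> S" "X \<inter> Y = {}" "finite X" "finite Y" for S X Y
  proof -
    have "card X + card Y = card (X \<union> Y)" using that by (simp add: card_Un_disjoint)
    also have "\<dots> \<le> card S" using that F by (intro card_mono) auto
    finally show ?thesis using F that by fastforce
  qed
  have d: "A \<inter> C = {}" "A \<inter> D = {}" "B \<inter> C = {}" "B \<inter> D = {}" using dis by auto
  \<comment> \<open>Complementary unions have \<open>2 * s + 1\<close> members together, so exactly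
    one of them has at most \<open>s\<close>.\<close>
  have *: "card A + card C \<le> s \<or> card B + card D \<le> s" "card A + card D \<le> s \<or> card B + card C \<le> s"
    and **: "\<not> (card A + card C \<le> s \<and> card B + card D \<le> s)"
      "\<not> (card A + card D \<le> s \<and> card B + card C \<le> s)"
    using total by linarith+
  obtain a b c e where w: "a \<in> A" "b \<in> B" "c \<in> C" "e \<in> D" using ne by auto
  \<comment> \<open>The part shared by the two surviving unions is \<open>A\<close>,
    \<open>C\<close>, \<open>D\<close>, \<open>B\<close> in this order of cases.\<close>
  consider "card A + card C \<le> s" "card A + card D \<le> s" | "card A + card C \<le> s" "card B + card C \<le> s"
    | "card B + card D \<le> s" "card A + card D \<le> s" | "card B + card D \<le> s" "card B + card C \<le> s"
    using * by blast
  then show ?thesis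
  proof cases
    case 1
    have "a \<in> S" if "S \<in> F" for S
      using F[OF that] bound[OF that] fin d ** 1 w by (metis subsetD)
    then show ?thesis by (rule suffices_Spy)
  next
    case 2
    have "c \<in> S" if "S \<in> F" for S
      using F[OF that] bound[OF that] fin d ** 2 w by (metis subsetD)
    then show ?thesis by (rule suffices_Spy)
  next
    case 3
    have "e \<in> S" if "S \<in> F" for S
      using F[OF that] bound[OF that] fin d ** 3 w by (metis subsetD)
    then show ?thesis by (rule suffices_Spy)
  next
    case 4
    have "b \<in> S" if "S \<in> F" for S
      using F[OF that] bound[OF that] fin d ** 4 w by (metis subsetD)
    then show ?thesis by (rule suffices_Spy)
  qed
qed

text \<open>All loose people \<open>W\<close> but one are compared with each other. If they are all equal, joining them
  to the split \<open>(A, B)\<close> makes its sides too unequal for the person left over to matter.\<close>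

lemma suffices_split_and_loose:
  assumes F: "\<And>S. S \<in> F \<Longrightarrow> finite S \<and> card S \<le> s \<and>
      (A \<subseteq> S \<and> B \<inter> S = {} \<or> B \<subseteq> S \<and> A \<inter> S = {})"
    and ne: "A \<noteq> {}" "B \<noteq> {}"
    and range: "A \<union> B \<union> W \<subseteq> {1..n}"
    and dis: "(A \<union> B) \<inter> W = {}"
    and total: "card A + card B + card W = 2 * s + 1"
    and loose: "card A + 3 \<le> card W + card B" "card B + 3 \<le> card W + card A"
  shows "suffices n F (card W - 1)"
proof -
  have fin: "finite A" "finite B" "finite W" using range by (auto intro: finite_subset)
  obtain a b where ab: "a \<in> A" "b \<in> B" using ne by auto
  have W3: "3 \<le> card W" using loose by linarith
  then obtain u where u: "u \<in> W" by fastforce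
  have "card (W - {u}) \<noteq> 0" using W3 u fin by simp
  then obtain w where w: "w \<in> W" "w \<noteq> u"
    by (metis Diff_iff card.empty equals0I singletonI)
  let ?Y = "W - {u, w}"
  have cY: "card ?Y = card W - 2" using u w fin by (simp add: card_Diff_subset)
  \<comment> \<open>\<open>w\<close> is left out of the comparisons with \<open>u\<close>; how the
    one remaining question is spent depends on \<open>D\<close>.\<close>
  have "suffices n F (1 + card ?Y)"
  proof (rule suffices_probe[of _ u])
    fix D assume D: "D \<subseteq> ?Y"
    let ?F = "{S \<in> F. {y \<in> ?Y. answers_yes S u y} = D}"
    have fD: "finite D" using D fin finite_subset by blast
    have cD: "card (?Y - D) + card D = card W - 2"
      using cY D fin fD card_mono[OF _ D] by (simp add: card_Diff_subset)
    have "suffices n ?F (Suc 0)"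
    proof (cases "D = {}")
      case True
      let ?W = "W - {w}"
      have cW: "card ?W = card W - 1" using w fin by simp
      have same: "?W \<subseteq> S" if "S \<in> ?F" "u \<in> S" for S
        using that True by (auto simp: answers_yes_iff)
      have big: "\<not> (X \<subseteq> S \<and> ?W \<subseteq> S)"
        if "S \<in> F" "X \<inter> W = {}" "finite X" "s < card X + card ?W" for S X
      proof
        assume sub: "X \<subseteq> S \<and> ?W \<subseteq> S"
        have "card X + card ?W = card (X \<union> ?W)"
          using that fin by (subst card_Un_disjoint) auto
        also have "\<dots> \<le> card S" using that sub F by (intro card_mono) auto
        finally show False using F that by fastforce
      qed
      \<comment> \<open>By \<open>total\<close>, twice \<open>card B + card W - 1\<close> is
        \<open>2 * s - 1 + (card W + card B - card A)\<close>, so the 3 in \<open>loose\<close>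
        makes it at least \<open>2 * s + 2\<close>. Hence neither side of the split can be spies
        together with \<open>?W\<close>.\<close>
      have Bbig: "s < card B + card ?W" and Abig: "s < card A + card ?W"
        using cW W3 loose total by linarith+
      have dB: "B \<inter> W = {}" and dA: "A \<inter> W = {}" using dis by auto
      show ?thesis
      proof (rule suffices_ask[of a _ u])
        show "suffices n {S \<in> ?F. answers_yes S a u} 0"
        proof (rule suffices_Spy[of _ a])
          fix S assume S: "S \<in> {S \<in> ?F. answers_yes S a u}"
          show "a \<in> S"
          proof (rule ccontr)
            assume "a \<notin> S"
            then have "B \<subseteq> S" "?W \<subseteq> S"
              using S F[of S] ab same[of S] by (auto simp: answers_yes_iff)
            then show False using big[of S B] S dB fin Bbig by blast
          qed
        qed
        show "suffices n {S \<in> ?F. \<not> answers_yes S a u} 0"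
        proof (rule suffices_Spy[of _ b])
          fix S assume S: "S \<in> {S \<in> ?F. \<not> answers_yes S a u}"
          show "b \<in> S"
          proof (rule ccontr)
            assume "b \<notin> S"
            then have "A \<subseteq> S" using S F[of S] ab by auto
            moreover from this have "?W \<subseteq> S"
              using S ab same[of S] by (auto simp: answers_yes_iff)
            ultimately show False using big[of S A] S dA fin Abig by blast
          qed
        qed
      qed (use ab u range dis in auto)
    next
      case False
      have ud: "u \<notin> ?Y - D" "w \<notin> D" "w \<notin> insert u (?Y - D)" using D w by auto
      \<comment> \<open>The last question places \<open>w\<close> in a second split, that of
        \<open>W\<close>; as \<open>D\<close> is nonempty, both its sides are nonempty for either
        answer.\<close>
      show ?thesis
      proof (rule suffices_ask[of u _ w])
        show "suffices n {S \<in> ?F. answers_yes S u w} 0"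
        proof (rule suffices_two_splits[of _ s A B "insert u (?Y - D)" "insert w D"])
          show "card A + card B + card (insert u (?Y - D)) + card (insert w D) = 2 * s + 1"
            using ud fin fD cD total W3 by simp
        qed (use F fin fD ne dis D u w in \<open>auto simp: answers_yes_iff\<close>)
        show "suffices n {S \<in> ?F. \<not> answers_yes S u w} 0"
        proof (rule suffices_two_splits[of _ s A B "insert w (insert u (?Y - D))" D])
          show "card A + card B + card (insert w (insert u (?Y - D))) + card D = 2 * s + 1"
            using ud fin fD cD total W3 w by simp
        qed (use F fin fD ne dis D u w False in \<open>auto simp: answers_yes_iff\<close>)
      qed (use u w range in auto)
    qed
    then show "suffices n ?F 1" by simp
  qed (use u w range fin in auto)
  then show ?thesis by (rule suffices_mono) (use cY W3 in auto)
qed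

text \<open>A block of \<open>s - 1\<close> equals is built, then a pair of equals, and these are compared: if equal, they are \<open>s + 1\<close> knights. Every ``yes'' on the way
  leads to one of the two preceding lemmas, except when the pair differs and the block grows to
  size \<open>s\<close>; then the block together with one of the pair has \<open>s + 1\<close> members.\<close>

lemma suffices_spy_of_odd:
  assumes s: "3 \<le> s"
    and F: "\<And>S. S \<in> F \<Longrightarrow> S \<subseteq> {1..2 * s + 1} \<and> card S \<le> s \<and> S \<noteq> {}"
  shows "suffices (2 * s + 1) F (2 * s - 1)"
proof -
  let ?n = "2 * s + 1" and ?Y = "{2..s - 1}" and ?A = "{1..s - 1}"
  have finS: "finite S" if "S \<in> F" for S using F[OF that] finite_subset by blast
  have A: "?A = insert 1 ?Y" using s by auto
  have large: False if "S \<in> F" "X \<subseteq> S" "s < card X" for S X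
    using card_mono[OF finS[OF that(1)] that(2)] F[OF that(1)] that(3) by simp
  \<comment> \<open>The block takes \<open>s - 2\<close> questions. The other \<open>s + 1\<close>
    are one for the pair \<open>s\<close>, \<open>s + 1\<close>, one more comparison with Person 1,
    and \<open>s - 1\<close> to finish.\<close>
  have "suffices ?n F ((s + 1) + card ?Y)"
  proof (rule suffices_probe[of _ 1])
    fix D assume D: "D \<subseteq> ?Y"
    let ?F = "{S \<in> F. {y \<in> ?Y. answers_yes S 1 y} = D}"
    show "suffices ?n ?F (s + 1)"
    proof (cases "D = {}")
      case False
      have fD: "finite D" using D finite_subset by blast
      have D0: "card D \<noteq> 0" using False fD by simp
      have D1: "1 \<notin> D" using D by auto
      have cD: "card D \<le> s - 2" using card_mono[OF _ D] s by simp
      have cAD: "card (?A - D) = s - 1 - card D"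
        using D fD A s by (subst card_Diff_subset) auto
      have "suffices ?n ?F (card {s..?n} - 1)"
      proof (rule suffices_split_and_loose[of _ s "?A - D" D])
        fix S assume S: "S \<in> ?F"
        have "\<forall>y\<in>?Y. y \<in> D \<longleftrightarrow> (y \<in> S \<longleftrightarrow> 1 \<notin> S)"
          using S by (auto simp: answers_yes_iff)
        then show "finite S \<and> card S \<le> s \<and>
            (?A - D \<subseteq> S \<and> D \<inter> S = {} \<or> D \<subseteq> S \<and> (?A - D) \<inter> S = {})"
          using S F[of S] finS[of S] D D1 unfolding A by auto
      next
        have "1 \<in> ?A - D" using A D1 by auto
        then show "?A - D \<noteq> {}" by blast
        have AD: "?A - D \<union> D = ?A" using D A by blast
        show "?A - D \<union> D \<union> {s..?n} \<subseteq> {1..?n}" unfolding AD using s by auto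
        show "(?A - D \<union> D) \<inter> {s..?n} = {}" unfolding AD using s by auto
      qed (use False cD cAD D0 s in auto)
      then show ?thesis using s by simp
    next
      case True
      have same: "?A \<subseteq> S \<and> 1 \<in> S \<or> ?A \<inter> S = {} \<and> 1 \<notin> S" if "S \<in> ?F" for S
      proof -
        have "\<forall>y\<in>?Y. y \<in> S \<longleftrightarrow> 1 \<in> S" using that True by (auto simp: answers_yes_iff)
        then show ?thesis unfolding A by auto
      qed
      have A1: "1 \<in> ?A" using A by simp
      have "suffices ?n ?F (Suc s)"
      proof (rule suffices_ask[of s _ "s + 1"])
        let ?G = "{S \<in> ?F. \<not> answers_yes S s (s + 1)}"
        have "suffices ?n ?G (Suc (s - 1))"
        proof (rule suffices_ask[of 1 _ s])
          let ?H = "{S \<in> ?G. answers_yes S 1 s}"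
          \<comment> \<open>The split has sides of sizes \<open>s - 1\<close> and 2, with
            \<open>s\<close> loose people. The first size condition is an equality; the second,
            \<open>5 \<le> 2 * s - 1\<close>, needs \<open>3 \<le> s\<close>.\<close>
          have "suffices ?n ?H (card {s + 2..?n} - 1)"
          proof (rule suffices_split_and_loose[of _ s ?A "{s, s + 1}"])
            fix S assume S: "S \<in> ?H"
            then have "s \<in> S \<longleftrightarrow> 1 \<notin> S" "s + 1 \<in> S \<longleftrightarrow> s \<in> S"
              by (auto simp: answers_yes_iff)
            then show "finite S \<and> card S \<le> s \<and> (?A \<subseteq> S \<and> {s, s + 1} \<inter> S = {} \<or>
                {s, s + 1} \<subseteq> S \<and> ?A \<inter> S = {})"
              using S same[of S] F[of S] finS[of S] by blast
          qed (use s in auto)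
          then show "suffices ?n ?H (s - 1)" using s by simp
        next
          \<comment> \<open>Person 1, now a knight, tests all but one of the remaining
            \<open>s\<close> people; if they pass, the last one must be the spy.\<close>
          let ?H = "{S \<in> ?G. \<not> answers_yes S 1 s}" and ?Z = "{s + 2..2 * s}"
          have A': "{1..s + 1} = ?A \<union> {s, s + 1}" using s by auto
          have kn: "{1..s + 1} \<inter> S = {}" if "S \<in> ?H" for S
          proof -
            have "s \<in> S \<longleftrightarrow> 1 \<in> S" "s + 1 \<in> S \<longleftrightarrow> s \<in> S"
              using that by (auto simp: answers_yes_iff)
            then have "{1..s + 1} \<subseteq> S \<or> {1..s + 1} \<inter> S = {}"
              unfolding A' using that same[of S] by blast
            then show ?thesis using large[of S "{1..s + 1}"] that by auto
          qed
          have k1: "1 \<notin> S" if "S \<in> ?H" for S using kn[OF that] by auto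
          have "suffices ?n ?H (0 + card ?Z)"
          proof (rule suffices_probe[of _ 1])
            fix E assume E: "E \<subseteq> ?Z"
            let ?J = "{S \<in> ?H. {y \<in> ?Z. answers_yes S 1 y} = E}"
            show "suffices ?n ?J 0"
            proof (cases "E = {}")
              case True
              show ?thesis
              proof (rule suffices_Spy[of _ ?n])
                fix S assume S: "S \<in> ?J"
                obtain x where x: "x \<in> S" using S F[of S] by auto
                have "x \<notin> ?Z" using S k1[of S] True x by (auto simp: answers_yes_iff)
                moreover have "x \<notin> {1..s + 1}" using S kn[of S] x by blast
                moreover have "x \<in> {1..?n}" using S F[of S] x by blast
                ultimately have "x = ?n" by auto
                then show "?n \<in> S" using x by simp
              qed
            next
              case False
              then obtain e where "e \<in> E" by auto
              then show ?thesis
                by (intro suffices_Spy[of _ e]) (use k1 in \<open>auto simp: answers_yes_iff\<close>)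
            qed
          qed (use s in auto)
          then show "suffices ?n ?H (s - 1)" by simp
        qed (use s in auto)
        then show "suffices ?n ?G s" using s by simp
      next
        let ?G = "{S \<in> ?F. answers_yes S s (s + 1)}"
        have "suffices ?n ?G (Suc (s - 1))"
        proof (rule suffices_ask[of 1 _ "s + 2"])
          \<comment> \<open>Sorting everyone outside the pair by comparison with Person 1 gives a
            second split, and the two splits cover all \<open>2 * s + 1\<close> people.\<close>
          let ?H = "{S \<in> ?G. answers_yes S 1 (s + 2)}" and ?Z = "{s + 3..?n}"
          have "suffices ?n ?H (0 + card ?Z)"
          proof (rule suffices_probe[of _ 1])
            fix E assume E: "E \<subseteq> ?Z"
            let ?J = "{S \<in> ?H. {y \<in> ?Z. answers_yes S 1 y} = E}"
            have fE: "finite E" using E finite_subset by blast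
            have cE: "card (?Z - E) + card E = s - 1"
              using E fE card_mono[OF _ E] by (simp add: card_Diff_subset)
            show "suffices ?n ?J 0"
            proof (rule suffices_two_splits[of _ s "?A \<union> (?Z - E)" "insert (s + 2) E" "{s}" "{s + 1}"])
              fix S assume S: "S \<in> ?J"
              have "\<forall>y\<in>?Z. y \<in> E \<longleftrightarrow> (y \<in> S \<longleftrightarrow> 1 \<notin> S)"
                using S by (auto simp: answers_yes_iff)
              moreover have "s + 2 \<in> S \<longleftrightarrow> 1 \<notin> S" "s \<in> S \<longleftrightarrow> s + 1 \<notin> S"
                using S by (auto simp: answers_yes_iff)
              ultimately show "finite S \<and> card S \<le> s \<and>
                  (?A \<union> (?Z - E) \<subseteq> S \<or> insert (s + 2) E \<subseteq> S) \<and> ({s} \<subseteq> S \<or> {s + 1} \<subseteq> S)"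
                using S same[of S] F[of S] finS[of S] E by blast
            next
              have "s + 2 \<notin> E" using E by auto
              moreover have "card (?A \<union> (?Z - E)) = s - 1 + card (?Z - E)"
                by (subst card_Un_disjoint) auto
              ultimately show "card (?A \<union> (?Z - E)) + card (insert (s + 2) E) + card {s} + card {s + 1}
                  = 2 * s + 1"
                using fE cE s by simp
              show "(?A \<union> (?Z - E) \<union> insert (s + 2) E) \<inter> ({s} \<union> {s + 1}) = {}"
                using E s by auto
            qed (use fE A1 in auto)
          qed (use s in auto)
          then show "suffices ?n ?H (s - 1)" using s by simp
        next
          let ?H = "{S \<in> ?G. \<not> answers_yes S 1 (s + 2)}"
          have known: "1 \<notin> S" if S: "S \<in> ?H" for S
          proof
            assume "1 \<in> S"
            then have "s + 2 \<in> S" "s \<in> S \<or> s + 1 \<in> S"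
              using S by (auto simp: answers_yes_iff)
            moreover have "?A \<subseteq> S" using S same[of S] \<open>1 \<in> S\<close> by blast
            ultimately obtain v where "v \<in> {s, s + 1}" "insert v (insert (s + 2) ?A) \<subseteq> S" by blast
            moreover from this have "s < card (insert v (insert (s + 2) ?A))"
              using s by (auto simp: card_insert_if)
            ultimately show False using large[of S] S by blast
          qed
          have "suffices ?n ?H (Suc (s - 2))"
          proof (rule suffices_ask[of 1 _ s])
            show "suffices ?n {S \<in> ?H. answers_yes S 1 s} (s - 2)"
              by (rule suffices_Spy[of _ s]) (use known in \<open>auto simp: answers_yes_iff\<close>)
            show "suffices ?n {S \<in> ?H. \<not> answers_yes S 1 s} (s - 2)"
              by (rule suffices_Spy[of _ "s + 1"]) (use known in \<open>auto simp: answers_yes_iff\<close>)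
          qed (use s in auto)
          moreover have "Suc (s - 2) = s - 1" using s by simp
          ultimately show "suffices ?n ?H (s - 1)" by metis
        qed (use s in auto)
        then show "suffices ?n ?G s" using s by simp
      qed (use s in auto)
      then show ?thesis by simp
    qed
  qed (use s in auto)
  moreover have "(s + 1) + card ?Y = 2 * s - 1" using s by simp
  ultimately show ?thesis by metis
qed

section \<open>Lower bounds\<close>

lemma suffices_0D:
  assumes "suffices n F 0"
  obtains v where "\<And>S. S \<in> F \<Longrightarrow> correct S v"
proof -
  obtain t where t: "\<forall>S\<in>F. correct S (outcome S t) \<and> questions_asked S t \<le> 0"
    using assms unfolding suffices_def by auto
  show thesis
  proof (cases t)
    case (Verdict v)
    then show ?thesis using t that by auto
  next
    case (Ask x y t1 t2)
    then have "F = {}" using t by auto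
    then show ?thesis using that by auto
  qed
qed

lemma suffices_SucD:
  assumes "suffices n F (Suc m)" "2 \<le> n"
  shows "\<exists>x\<in>{1..n}. \<exists>y\<in>{1..n}. x \<noteq> y \<and>
    suffices n {S \<in> F. answers_yes S x y} m \<and> suffices n {S \<in> F. \<not> answers_yes S x y} m"
proof -
  obtain t where t: "legal n t" "\<forall>S\<in>F. correct S (outcome S t) \<and> questions_asked S t \<le> Suc m"
    using assms unfolding suffices_def by auto
  show ?thesis
  proof (cases t)
    \<comment> \<open>A strategy that stops early may as well ask Person 1 about Person 2, who
      exists as \<open>2 \<le> n\<close>.\<close>
    case (Verdict v)
    then have "suffices n F m" using t by (intro suffices_verdict[of _ v]) auto
    then have "suffices n {S \<in> F. P S} m" for P by (rule suffices_mono) auto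
    then show ?thesis using assms by (intro bexI[of _ 1] bexI[of _ 2]) auto
  next
    case (Ask x y t1 t2)
    have "suffices n {S \<in> F. answers_yes S x y} m"
      unfolding suffices_def using t Ask by (intro exI[of _ t1]) auto
    moreover have "suffices n {S \<in> F. \<not> answers_yes S x y} m"
      unfolding suffices_def using t Ask by (intro exI[of _ t2]) auto
    ultimately show ?thesis using t Ask by (intro bexI[of _ x] bexI[of _ y]) auto
  qed
qed

text \<open>Partitions are encoded by labellings \<open>f\<close>, so that merging two classes is a
  mere relabelling.\<close>

definition union_of_fibres :: "nat \<Rightarrow> (nat \<Rightarrow> nat) \<Rightarrow> nat set \<Rightarrow> bool" where
  "union_of_fibres n f S \<longleftrightarrow> (\<forall>x\<in>{1..n}. \<forall>y\<in>{1..n}. f x = f y \<longrightarrow> (x \<in> S \<longleftrightarrow> y \<in> S))"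

definition fibre :: "nat \<Rightarrow> (nat \<Rightarrow> nat) \<Rightarrow> nat \<Rightarrow> nat set" where
  "fibre n f c = {x \<in> {1..n}. f x = c}"

lemma union_of_fibres_fibre [simp]: "union_of_fibres n f (fibre n f c)"
  and union_of_fibres_empty [simp]: "union_of_fibres n f {}"
  by (auto simp: union_of_fibres_def fibre_def)

lemma fibre_subset: "fibre n f c \<subseteq> {1..n}"
  by (auto simp: fibre_def)

lemma fibre_nonempty: "c \<in> f ` {1..n} \<Longrightarrow> fibre n f c \<noteq> {}"
  by (auto simp: fibre_def)

lemma fibre_disjoint: "c \<noteq> d \<Longrightarrow> fibre n f c \<inter> fibre n f d = {}"
  by (auto simp: fibre_def)

text \<open>The questioner's knowledge while every answer is ``no'': the fibres of \<open>f\<close> are the classes of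
  people known to be of the same kind, and each question merges at most two of them.\<close>

lemma all_no_path_step:
  assumes "suffices n {S \<in> F. union_of_fibres n f S} (j + i)" "2 \<le> n"
  shows "\<exists>g :: nat \<Rightarrow> nat. card (f ` {1..n}) \<le> card (g ` {1..n}) + j \<and>
    suffices n {S \<in> F. union_of_fibres n g S} i"
  using assms
proof (induction j arbitrary: f)
  case 0
  then show ?case by auto
next
  case (Suc j)
  then have "suffices n {S \<in> F. union_of_fibres n f S} (Suc (j + i))" by simp
  from suffices_SucD[OF this \<open>2 \<le> n\<close>] obtain x y where xy: "x \<in> {1..n}" "y \<in> {1..n}"
    and no: "suffices n {S \<in> {S \<in> F. union_of_fibres n f S}. \<not> answers_yes S x y} (j + i)"
    by (elim bexE conjE) (rule that)
  define g where "g z = (if f z = f y then f x else f z)" for z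
  have "suffices n {S \<in> F. union_of_fibres n g S} (j + i)"
  proof (rule suffices_mono[OF no])
    have "union_of_fibres n f S \<and> \<not> answers_yes S x y" if "union_of_fibres n g S" for S
    proof
      show "union_of_fibres n f S"
        using that unfolding union_of_fibres_def g_def by metis
      have "g x = g y" by (simp add: g_def)
      then show "\<not> answers_yes S x y"
        using that xy unfolding union_of_fibres_def answers_yes_iff by metis
    qed
    then show "{S \<in> F. union_of_fibres n g S}
        \<subseteq> {S \<in> {S \<in> F. union_of_fibres n f S}. \<not> answers_yes S x y}" by blast
  qed simp
  then obtain h where h: "card (g ` {1..n}) \<le> card (h ` {1..n}) + j"
    "suffices n {S \<in> F. union_of_fibres n h S} i"
    using Suc.IH \<open>2 \<le> n\<close> by blast
  \<comment> \<open>Only the label \<open>f y\<close> can disappear.\<close>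
  have "f ` {1..n} - {f y} \<subseteq> g ` {1..n}" by (auto simp: g_def intro!: image_eqI)
  then have "card (f ` {1..n} - {f y}) \<le> card (g ` {1..n})" by (intro card_mono) auto
  moreover have "card (f ` {1..n}) \<le> Suc (card (f ` {1..n} - {f y}))"
    using xy by (subst card_Suc_Diff1) auto
  ultimately have "card (f ` {1..n}) \<le> card (h ` {1..n}) + Suc j" using h by linarith
  then show ?case using h by blast
qed

text \<open>The path starts from singletons. The last \<open>i\<close> questions stay open, so that
  with \<open>i = 1\<close> the adversary can still choose the final answer.\<close>

lemma all_no_path:
  assumes "suffices n F (j + i)" "2 \<le> n"
  obtains f :: "nat \<Rightarrow> nat" where "n \<le> card (f ` {1..n}) + j"
    "suffices n {S \<in> F. union_of_fibres n f S} i"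
proof -
  have "suffices n {S \<in> F. union_of_fibres n (\<lambda>x. x) S} (j + i)"
    by (rule suffices_mono[OF assms(1)]) auto
  from all_no_path_step[OF this assms(2)] show thesis using that by auto
qed

section \<open>Counting the classes small enough to be the set of all spies\<close>

definition small_fibres :: "nat \<Rightarrow> (nat \<Rightarrow> nat) \<Rightarrow> nat \<Rightarrow> nat set" where
  "small_fibres n f s = {c \<in> f ` {1..n}. card (fibre n f c) \<le> s}"

text \<open>Class sizes add up to \<open>n\<close>; a small class has at least one member, any other
  at least \<open>s + 1\<close>.\<close>

lemma card_small_fibres:
  "(card (f ` {1..n}) - card (small_fibres n f s)) * (s + 1) + card (small_fibres n f s) \<le> n"
proof -
  let ?K = "small_fibres n f s" and ?I = "f ` {1..n}"
  have K: "?K \<subseteq> ?I" by (auto simp: small_fibres_def)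
  have fK: "finite ?K" using K finite_subset by blast
  have "{1..n} = (\<Union>c\<in>?I. fibre n f c)" by (auto simp: fibre_def)
  moreover have "card (\<Union>c\<in>?I. fibre n f c) = (\<Sum>c\<in>?I. card (fibre n f c))"
    using fibre_disjoint finite_subset[OF fibre_subset] by (intro card_UN_disjoint) auto
  ultimately have total: "(\<Sum>c\<in>?I. card (fibre n f c)) = n"
    by (metis card_atLeastAtMost diff_Suc_1)
  have "(card ?I - card ?K) * (s + 1) + card ?K = (\<Sum>c\<in>?I - ?K. s + 1) + (\<Sum>c\<in>?K. 1)"
    using K fK by (simp add: card_Diff_subset)
  also have "\<dots> \<le> (\<Sum>c\<in>?I - ?K. card (fibre n f c)) + (\<Sum>c\<in>?K. card (fibre n f c))"
  proof (intro add_mono sum_mono)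
    fix c assume "c \<in> ?K"
    then have "fibre n f c \<noteq> {}" using K fibre_nonempty by blast
    then show "1 \<le> card (fibre n f c)"
      using finite_subset[OF fibre_subset] by (simp add: Suc_le_eq card_gt_0_iff)
  qed (auto simp: small_fibres_def)
  also have "\<dots> = (\<Sum>c\<in>?I. card (fibre n f c))"
    using K by (intro sum.subset_diff[symmetric]) auto
  also note total
  finally show ?thesis .
qed

text \<open>There are at least \<open>c + d - 1\<close> classes. With fewer than \<open>d\<close>
  small ones, at least \<open>c\<close> are large, and together they would need at least
  \<open>c * (s + 1) + d - 1\<close> people, more than \<open>n\<close>.\<close>

lemma small_fibres_ge:
  assumes "n + 1 < c * (s + 1) + d" "c + d \<le> card (f ` {1..n}) + 1"
  shows "d \<le> card (small_fibres n f s)"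
proof (rule ccontr)
  let ?k = "card (small_fibres n f s)" and ?i = "card (f ` {1..n})"
  assume "\<not> d \<le> ?k"
  then have k: "?k + 1 \<le> d" by simp
  have "c + (d - 1 - ?k) \<le> ?i - ?k" using assms(2) k by linarith
  then have "(c + (d - 1 - ?k)) * (s + 1) \<le> (?i - ?k) * (s + 1)" by (rule mult_right_mono) simp
  moreover have "(c + (d - 1 - ?k)) * (s + 1) = c * (s + 1) + (d - 1 - ?k) * (s + 1)"
    by (simp add: algebra_simps)
  moreover have "d - 1 - ?k \<le> (d - 1 - ?k) * (s + 1)" by simp
  ultimately show False using card_small_fibres[of f n s] assms(1) k by linarith
qed

section \<open>Adversary bounds\<close>

definition at_most_spies :: "nat \<Rightarrow> nat \<Rightarrow> nat set set" where
  "at_most_spies n s = {S. S \<subseteq> {1..n} \<and> card S \<le> s}"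

lemma identities_eq: "k \<le> n \<Longrightarrow> identities n k = at_most_spies n (n - k)"
proof -
  assume k: "k \<le> n"
  have "k \<le> card ({1..n} - S) \<longleftrightarrow> card S \<le> n - k" if "S \<subseteq> {1..n}" for S
    using that k card_mono[OF _ that] finite_subset[OF that] by (auto simp: card_Diff_subset)
  then show ?thesis by (auto simp: identities_def at_most_spies_def)
qed

lemma small_fibre:
  assumes "c \<in> small_fibres n f s"
  shows "fibre n f c \<in> at_most_spies n s" "fibre n f c \<noteq> {}"
  using assms fibre_subset fibre_nonempty by (auto simp: small_fibres_def at_most_spies_def)

text \<open>A named spy would lie in both sets, so only \<open>All_Knights\<close> can fit
  both.\<close>

lemma common_verdictD:
  assumes "suffices n F 0" "S \<in> F" "T \<in> F" "S \<inter> T = {}"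
  shows "S = {} \<and> T = {}"
proof -
  from suffices_0D[OF assms(1)] obtain v where "\<And>S. S \<in> F \<Longrightarrow> correct S v" by blast
  then have "correct S v" "correct T v" using assms by auto
  then show ?thesis using assms(4) by (cases v) auto
qed

lemma small_fibre_untouched:
  assumes "x \<in> {1..n}" "y \<in> {1..n}" "c = f x \<longleftrightarrow> c = f y"
  shows "\<not> answers_yes (fibre n f c) x y"
  using assms by (auto simp: answers_yes_iff fibre_def)

text \<open>With fewer questions at least \<open>q + 1\<close> classes are left, one of them small;
  it and the empty set admit no common verdict.\<close>

lemma T_bar_lower:
  assumes "suffices n (at_most_spies n s) m" "2 \<le> n" "n < (q + 1) * (s + 1)"
  shows "n - q \<le> m"
proof (rule ccontr)
  assume "\<not> n - q \<le> m"
  then have m: "m + q + 1 \<le> n" by simp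
  have "suffices n (at_most_spies n s) (m + 0)" using assms by simp
  from all_no_path[OF this assms(2)] obtain f where f: "n \<le> card (f ` {1..n}) + m"
    "suffices n {S \<in> at_most_spies n s. union_of_fibres n f S} 0" .
  have "1 \<le> card (small_fibres n f s)"
    by (rule small_fibres_ge[of n "q + 1"]) (use assms f m in auto)
  then obtain c where c: "c \<in> small_fibres n f s" by fastforce
  show False
    using common_verdictD[OF f(2), of "{}" "fibre n f c"] small_fibre[OF c]
    by (auto simp: at_most_spies_def)
qed

text \<open>Before the last of \<open>n - q\<close> questions there are at least
  \<open>q + 1\<close> classes, two of them small. The last question must separate each small class
  from the empty set, so \<open>x\<close> and \<open>y\<close> lie in exactly these two; after "yes"
  both remain possible, and they are disjoint.\<close>

lemma T_bar_lower_exact: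
  assumes "suffices n (at_most_spies n s) m" "2 \<le> n" "n = q * (s + 1)" "1 \<le> s" "1 \<le> q"
  shows "n - q + 1 \<le> m"
proof (rule ccontr)
  assume "\<not> n - q + 1 \<le> m"
  moreover have "q + 1 \<le> n" using assms by (cases q) auto
  ultimately have "suffices n (at_most_spies n s) ((n - q - 1) + 1)"
    by (intro suffices_mono[OF assms(1)]) auto
  from all_no_path[OF this assms(2)] obtain f where f: "n \<le> card (f ` {1..n}) + (n - q - 1)"
    and "suffices n {S \<in> at_most_spies n s. union_of_fibres n f S} (Suc 0)" by auto
  from suffices_SucD[OF this(2) assms(2)] obtain x y where xy: "x \<in> {1..n}" "y \<in> {1..n}" "x \<noteq> y"
    and yes: "suffices n {S \<in> {S \<in> at_most_spies n s. union_of_fibres n f S}. answers_yes S x y} 0"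
    and no: "suffices n {S \<in> {S \<in> at_most_spies n s. union_of_fibres n f S}. \<not> answers_yes S x y} 0"
    by (elim bexE conjE) (rule that)
  let ?K = "small_fibres n f s"
  have "2 \<le> card ?K"
  proof (rule small_fibres_ge[of n q])
    show "q + 2 \<le> card (f ` {1..n}) + 1" using f \<open>q + 1 \<le> n\<close> by linarith
  qed (use assms in simp)
  have touched: "c = f x \<longleftrightarrow> c \<noteq> f y" if c: "c \<in> ?K" for c
    using common_verdictD[OF no, of "{}" "fibre n f c"] small_fibre[OF c]
      small_fibre_untouched[OF xy(1,2), of c f]
    by (auto simp: at_most_spies_def answers_yes_iff)
  have "?K \<subseteq> {f x, f y}" using touched by blast
  moreover have "card {f x, f y} \<le> 2" by (simp add: card_insert_if)
  ultimately have K: "?K = {f x, f y}"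
    using \<open>2 \<le> card ?K\<close> by (intro card_subset_eq) (auto intro: le_antisym order_trans card_mono)
  then have ne: "f x \<noteq> f y" using touched by blast
  have "answers_yes (fibre n f (f x)) x y" "answers_yes (fibre n f (f y)) x y"
    using ne xy by (auto simp: answers_yes_iff fibre_def)
  then show False
    using common_verdictD[OF yes, of "fibre n f (f x)" "fibre n f (f y)"] K
      small_fibre[of "f x" n f s] small_fibre[of "f y" n f s] fibre_disjoint[OF ne]
    by auto
qed

text \<open>As the empty set is excluded, two small classes are needed to defeat every
  verdict.\<close>

lemma T_tilde_lower:
  assumes "suffices n {S \<in> at_most_spies n s. S \<noteq> {}} m" "2 \<le> n" "n < c * (s + 1) + 1"
  shows "n - c \<le> m"
proof (rule ccontr)
  assume "\<not> n - c \<le> m"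
  then have m: "m + c + 1 \<le> n" by simp
  have "suffices n {S \<in> at_most_spies n s. S \<noteq> {}} (m + 0)" using assms by simp
  from all_no_path[OF this assms(2)] obtain f where f: "n \<le> card (f ` {1..n}) + m"
    "suffices n {S \<in> {S \<in> at_most_spies n s. S \<noteq> {}}. union_of_fibres n f S} 0" .
  have "2 \<le> card (small_fibres n f s)"
    by (rule small_fibres_ge[of n c]) (use assms f m in auto)
  then obtain a b where ab: "a \<in> small_fibres n f s" "b \<in> small_fibres n f s" "a \<noteq> b"
    by (meson card_2_iff' obtain_subset_with_card_n subsetD)
  show False
    using common_verdictD[OF f(2), of "fibre n f a" "fibre n f b"] small_fibre[OF ab(1)]
      small_fibre[OF ab(2)] fibre_disjoint[OF ab(3)]
    by auto
qed

text \<open>Before the last of \<open>n - q - 1\<close> questions there are three small classes. Two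
  of them untouched by it would survive a "no", so it must join two small classes, and these survive
  a "yes".\<close>

lemma T_tilde_lower_one:
  assumes "suffices n {S \<in> at_most_spies n s. S \<noteq> {}} m" "2 \<le> n" "n = q * (s + 1) + 1"
    "1 \<le> s" "1 \<le> q"
  shows "n - q \<le> m"
proof (rule ccontr)
  let ?F = "{S \<in> at_most_spies n s. S \<noteq> {}}"
  assume "\<not> n - q \<le> m"
  moreover have "q + 2 \<le> n" using assms by (cases q) auto
  ultimately have "suffices n ?F ((n - q - 2) + 1)"
    by (intro suffices_mono[OF assms(1)]) auto
  from all_no_path[OF this assms(2)] obtain f where f: "n \<le> card (f ` {1..n}) + (n - q - 2)"
    and "suffices n {S \<in> ?F. union_of_fibres n f S} (Suc 0)" by auto
  from suffices_SucD[OF this(2) assms(2)] obtain x y where xy: "x \<in> {1..n}" "y \<in> {1..n}" "x \<noteq> y"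
    and yes: "suffices n {S \<in> {S \<in> ?F. union_of_fibres n f S}. answers_yes S x y} 0"
    and no: "suffices n {S \<in> {S \<in> ?F. union_of_fibres n f S}. \<not> answers_yes S x y} 0"
    by (elim bexE conjE) (rule that)
  let ?K = "small_fibres n f s"
  have "3 \<le> card ?K"
  proof (rule small_fibres_ge[of n q])
    show "q + 3 \<le> card (f ` {1..n}) + 1" using f \<open>q + 2 \<le> n\<close> by linarith
  qed (use assms in simp)
  have touched: "(a = f x \<longleftrightarrow> a \<noteq> f y) \<or> (b = f x \<longleftrightarrow> b \<noteq> f y)"
    if "a \<in> ?K" "b \<in> ?K" "a \<noteq> b" for a b
    using common_verdictD[OF no, of "fibre n f a" "fibre n f b"] small_fibre[OF that(1)]
      small_fibre[OF that(2)] fibre_disjoint[OF that(3)]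
      small_fibre_untouched[OF xy(1,2), of a f] small_fibre_untouched[OF xy(1,2), of b f]
    by auto
  have "f x \<in> ?K \<and> f y \<in> ?K \<and> f x \<noteq> f y"
  proof (rule ccontr)
    assume neg: "\<not> ?thesis"
    \<comment> \<open>A question inside one class touches no class; otherwise \<open>z\<close> is
      the only small class it can touch. Two of the three small classes stay untouched either
      way.\<close>
    obtain z where z: "?K \<inter> {f x, f y} \<subseteq> {z} \<or> f x = f y" using neg by blast
    have "2 \<le> card (?K - (if f x = f y then {} else {z}))"
      using \<open>3 \<le> card ?K\<close> diff_card_le_card_Diff[of "{z}" ?K] by auto
    then obtain a b where ab: "a \<noteq> b"
      "a \<in> ?K - (if f x = f y then {} else {z})" "b \<in> ?K - (if f x = f y then {} else {z})"
      by (meson card_2_iff' obtain_subset_with_card_n subsetD)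
    then have "a \<in> ?K" "b \<in> ?K" by auto
    from touched[OF this ab(1)] show False using z ab(2,3) by (auto split: if_splits)
  qed
  then have K: "f x \<in> ?K" "f y \<in> ?K" and ne: "f x \<noteq> f y" by auto
  have "answers_yes (fibre n f (f x)) x y" "answers_yes (fibre n f (f y)) x y"
    using ne xy by (auto simp: answers_yes_iff fibre_def)
  then show False
    using common_verdictD[OF yes, of "fibre n f (f x)" "fibre n f (f y)"]
      small_fibre[OF K(1)] small_fibre[OF K(2)] fibre_disjoint[OF ne]
    by auto
qed

text \<open>For \<open>n = 5\<close>, \<open>k = 3\<close> the counting bound is not attained; the game tree of depth 3 is
  searched by rewriting, with families of spy sets represented by lists of lists.\<close>

fun winnable :: "nat \<Rightarrow> nat list list \<Rightarrow> bool" where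
  "winnable 0 Fs \<longleftrightarrow> list_ex (\<lambda>v. list_all (\<lambda>xs. List.member xs v) Fs) [1, 2, 3, 4, 5]"
| "winnable (Suc m) Fs \<longleftrightarrow> list_ex (\<lambda>(x, y).
     winnable m (filter (\<lambda>xs. List.member xs x \<noteq> List.member xs y) Fs) \<and>
     winnable m (filter (\<lambda>xs. List.member xs x = List.member xs y) Fs))
     [(1, 2), (1, 3), (1, 4), (1, 5), (2, 3), (2, 4), (2, 5), (3, 4), (3, 5), (4, 5)]"

lemma winnable_if_suffices:
  assumes "suffices 5 (set ` set Fs) m" "\<forall>xs\<in>set Fs. xs \<noteq> [] \<and> set xs \<subseteq> {1..5}"
  shows "winnable m Fs"
  using assms
proof (induction m arbitrary: Fs)
  case 0
  from suffices_0D[OF 0(1)] obtain v where v: "\<And>S. S \<in> set ` set Fs \<Longrightarrow> correct S v" by blast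
  show ?case
  proof (cases Fs)
    case Nil
    then show ?thesis by simp
  next
    case (Cons xs Gs)
    then have "correct (set xs) v" "xs \<noteq> []" "set xs \<subseteq> {1..5}" using v 0(2) by auto
    \<comment> \<open>Nonemptiness of \<open>xs\<close> rules out \<open>All_Knights\<close>, so
      \<open>winnable\<close> need only try naming a spy.\<close>
    then obtain x where x: "v = Spy x" "x \<in> {1..5}" by (cases v) auto
    have "list_all (\<lambda>xs. List.member xs x) Fs"
      using v x by (auto simp: list_all_iff)
    moreover have "x \<in> set [1, 2, 3, 4, 5]" using x by auto
    ultimately show ?thesis unfolding winnable.simps list_ex_iff by blast
  qed
next
  case (Suc m)
  have "(2 :: nat) \<le> 5" by simp
  from suffices_SucD[OF Suc.prems(1) this] obtain x y
    where xy: "x \<in> {1..5}" "y \<in> {1..5}" "x \<noteq> y"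
      and yes: "suffices 5 {S \<in> set ` set Fs. answers_yes S x y} m"
      and no: "suffices 5 {S \<in> set ` set Fs. \<not> answers_yes S x y} m"
    by (elim bexE conjE) (rule that)
  have 1: "winnable m (filter (\<lambda>xs. List.member xs x \<noteq> List.member xs y) Fs)"
    by (rule Suc.IH[OF suffices_mono[OF yes]]) (use Suc.prems in \<open>auto simp: answers_yes_iff\<close>)
  have 2: "winnable m (filter (\<lambda>xs. List.member xs x = List.member xs y) Fs)"
    by (rule Suc.IH[OF suffices_mono[OF no]]) (use Suc.prems in \<open>auto simp: answers_yes_iff\<close>)
  \<comment> \<open>The answer is symmetric in \<open>x\<close> and \<open>y\<close>, so
    \<open>winnable\<close> lists unordered pairs only.\<close>
  have swap: "(\<lambda>xs. List.member xs x \<noteq> List.member xs y) = (\<lambda>xs. List.member xs y \<noteq> List.member xs x)"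
    "(\<lambda>xs. List.member xs x = List.member xs y) = (\<lambda>xs. List.member xs y = List.member xs x)"
    by auto
  let ?L = "[(1, 2), (1, 3), (1, 4), (1, 5), (2, 3), (2, 4), (2, 5), (3, 4), (3, 5), (4, 5)]"
  have mem: "x \<in> {1, 2, 3, 4, 5}" "y \<in> {1, 2, 3, 4, 5}" using xy by auto
  have "(x, y) \<in> set ?L \<or> (y, x) \<in> set ?L" using mem xy(3) by auto
  then show ?case
    unfolding winnable.simps list_ex_iff using 1 2 swap by (metis (no_types, lifting) case_prodI)
qed

text \<open>The list enumerates the nonempty sets of at most two among five people.\<close>

lemma not_winnable_5_3:
  "\<not> winnable 3 [[1], [2], [3], [4], [5], [1, 2], [1, 3], [1, 4], [1, 5], [2, 3], [2, 4], [2, 5],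
     [3, 4], [3, 5], [4, 5]]"
  by code_simp

lemma T_tilde_lower_5_3:
  assumes "suffices 5 {S \<in> at_most_spies 5 2. S \<noteq> {}} m"
  shows "4 \<le> m"
proof (rule ccontr)
  assume "\<not> 4 \<le> m"
  then have three: "suffices 5 {S \<in> at_most_spies 5 2. S \<noteq> {}} 3"
    by (intro suffices_mono[OF assms]) auto
  have "winnable 3 [[1], [2], [3], [4], [5], [1, 2], [1, 3], [1, 4], [1, 5], [2, 3], [2, 4], [2, 5],
     [3, 4], [3, 5], [4, 5]]"
    by (rule winnable_if_suffices, rule suffices_mono[OF three])
      (auto simp: at_most_spies_def card_insert_if)
  then show False using not_winnable_5_3 by contradiction
qed

section \<open>The values\<close>

lemma questions_needed_eq:
  assumes "suffices n F M" "\<And>m. suffices n F m \<Longrightarrow> M \<le> m"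
  shows "questions_needed n F = enat M"
  unfolding questions_needed_def
  by (rule antisym) (auto intro!: Inf_lower Inf_greatest simp: assms)

theorem theorem1:
  fixes n k q r :: nat
  assumes "real n / 2 < real k" and "k < n"
    and "n = q * (n - k + 1) + r" and "r \<le> n - k"
  shows "T_bar n k = enat (if r = 0 then n - q + 1 else n - q) \<and>
    T_tilde n k =
      enat (if n = 5 \<and> k = 3 then 4 else if r \<in> {0, 1} then n - q else n - q - 1)"
proof -
  define s where "s = n - k"
  have k: "k \<le> n" "n = k + s" and s1: "1 \<le> s" using assms(2) by (auto simp: s_def)
  have "real n < 2 * real k" using assms(1) by simp
  then have "n < 2 * k" by linarith
  then have ns: "2 * s + 1 \<le> n" using k by simp
  then have n2: "2 \<le> n" using s1 by simp
  have n: "n = q * (s + 1) + r" and r: "r \<le> s" using assms(3,4) by (simp_all add: s_def)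
  have q1: "1 \<le> q" using n r ns s1 by (cases q) auto
  have lt: "n < (q + 1) * (s + 1)" using n r by simp
  let ?F = "at_most_spies n s"
  let ?G = "{S \<in> at_most_spies n s. S \<noteq> {}}"
  have id: "identities n k = ?F" using identities_eq[OF k(1)] by (simp add: s_def)
  have F: "finite S \<and> 0 \<notin> S \<and> card S \<le> s" if "S \<in> ?F" for S
    using that finite_subset[of S "{1..n}"] by (auto simp: at_most_spies_def)
  have range: "S \<subseteq> {1..n}" if "S \<in> ?F" for S using that by (auto simp: at_most_spies_def)

  have bar_pos: "suffices n ?F (n - q)" if "1 \<le> r"
  proof -
    have "suffices n ?F (n - q + 0)"
    proof (rule suffices_initial_segment[OF F n that q1 ns order_refl s1])
      show "suffices n {S \<in> ?F. S \<inter> {1..n} = {}} 0"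
        by (rule suffices_All_Knights) (use range in blast)
    qed
    then show ?thesis by simp
  qed
  \<comment> \<open>Here Person \<open>n\<close> is left out; \<open>m\<close> questions remain for
    the case that all the others are knights.\<close>
  have skip_last: "suffices n H (n - 1 - q' + m)"
    if "H \<subseteq> ?F" "n - 1 = q' * (s + 1) + r'" "1 \<le> r'" "1 \<le> q'" "2 * s + 1 \<le> n - 1"
      "suffices n {S \<in> H. S \<inter> {1..n - 1} = {}} m" for H q' r' m
    by (rule suffices_initial_segment[OF _ that(2-5) _ s1 that(6)]) (use F that(1) in auto)
  have last_only: "S = {} \<or> S = {n}" if "S \<in> ?F" "S \<inter> {1..n - 1} = {}" for S
  proof -
    have "S \<subseteq> {n}"
    proof
      fix x assume x: "x \<in> S"
      then have "x \<in> {1..n}" "x \<notin> {1..n - 1}" using that range by blast+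
      then show "x \<in> {n}" by auto
    qed
    then show ?thesis by blast
  qed
  \<comment> \<open>For \<open>r = 0\<close>, leaving out one person turns the remainder into
    \<open>s\<close>, which is positive as \<open>suffices_initial_segment\<close> requires.\<close>
  have r0: "2 \<le> q" "n - 1 = (q - 1) * (s + 1) + s" "2 * s + 1 \<le> n - 1" if "r = 0"
  proof -
    show "2 \<le> q"
    proof (rule ccontr)
      assume "\<not> 2 \<le> q"
      then have "q = 1" using q1 by simp
      then show False using n that ns s1 by simp
    qed
    then obtain p where p: "q = Suc (Suc p)" by (metis add_2_eq_Suc le_Suc_ex)
    show "n - 1 = (q - 1) * (s + 1) + s" "2 * s + 1 \<le> n - 1" using n that p by simp_all
  qed

  have bar: "T_bar n k = enat (if r = 0 then n - q + 1 else n - q)"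
  proof (cases "r = 0")
    case True
    have "suffices n ?F (n - 1 - (q - 1) + 1)"
    proof (rule skip_last[OF subset_refl r0(2)[OF True] s1 _ r0(3)[OF True]])
      show "suffices n {S \<in> ?F. S \<inter> {1..n - 1} = {}} 1"
        unfolding One_nat_def
      proof (rule suffices_ask[of 1 _ n])
        let ?H = "{S \<in> ?F. S \<inter> {Suc 0..n - Suc 0} = {}}"
        show "suffices n {S \<in> ?H. answers_yes S 1 n} 0"
          by (rule suffices_Spy[of _ n]) (use last_only n2 in \<open>auto simp: answers_yes_iff\<close>)
        show "suffices n {S \<in> ?H. \<not> answers_yes S 1 n} 0"
          by (rule suffices_All_Knights) (use last_only n2 in \<open>auto simp: answers_yes_iff\<close>)
      qed (use n2 in auto)
    qed (use r0(1)[OF True] in auto)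
    moreover have "n - 1 - (q - 1) + 1 = n - q + 1" using q1 by simp
    ultimately have "suffices n ?F (n - q + 1)" by metis
    moreover have "n - q + 1 \<le> m" if "suffices n ?F m" for m
      using T_bar_lower_exact[OF that n2 _ s1 q1] n True by simp
    ultimately show ?thesis
      unfolding T_bar_def id using True by (simp add: questions_needed_eq)
  next
    case False
    then show ?thesis
      unfolding T_bar_def id
      using questions_needed_eq[OF bar_pos T_bar_lower[OF _ n2 lt]] by simp
  qed

  have tilde: "T_tilde n k = enat M" if "suffices n ?G M" "\<And>m. suffices n ?G m \<Longrightarrow> M \<le> m" for M
    unfolding T_tilde_def id using questions_needed_eq[OF that] .
  have spy_last: "suffices n {S \<in> ?G. S \<inter> {1..n - 1} = {}} 0"
    by (rule suffices_Spy[of _ n]) (use last_only in blast)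
  have GF: "?G \<subseteq> ?F" by blast
  consider "n = 5" "k = 3" | "r = 0" | "r = 1" "\<not> (n = 5 \<and> k = 3)" | "2 \<le> r" "\<not> (n = 5 \<and> k = 3)" "2 \<le> q"
    | "2 \<le> r" "\<not> (n = 5 \<and> k = 3)" "q = 1"
    using q1 by linarith
  then have "T_tilde n k =
      enat (if n = 5 \<and> k = 3 then 4 else if r \<in> {0, 1} then n - q else n - q - 1)"
  proof cases
    case 1
    then have s2: "s = 2" by (simp add: s_def)
    have "q < 2" using n 1 s2 by (cases "q < 2") (auto dest!: mult_le_mono1[of 2 q 3])
    then have "q = 1" using q1 by simp
    then have "r = 2" using n 1 s2 by simp
    then have "suffices n ?F 4" using bar_pos 1 \<open>q = 1\<close> by simp
    then have "suffices n ?G 4" by (rule suffices_mono) auto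
    then show ?thesis
      using tilde[of 4] T_tilde_lower_5_3 1 s2 by simp
  next
    case 2
    have "suffices n ?G (n - 1 - (q - 1) + 0)"
      by (rule skip_last[OF GF r0(2)[OF 2] s1 _ r0(3)[OF 2] spy_last]) (use r0(1)[OF 2] in simp)
    moreover have "n - 1 - (q - 1) + 0 = n - q" using q1 by simp
    ultimately have "suffices n ?G (n - q)" by metis
    moreover have "n - q \<le> m" if "suffices n ?G m" for m
      using T_tilde_lower[OF that n2, of q] n 2 by simp
    moreover have "\<not> (n = 5 \<and> k = 3)"
    proof
      assume "n = 5 \<and> k = 3"
      moreover from this have "s = 2" by (simp add: s_def)
      ultimately have "q * 3 = 5" using n 2 by simp
      then show False by presburger
    qed
    ultimately show ?thesis using tilde 2 by auto
  next
    case 3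
    have "suffices n ?G (n - q)" by (rule suffices_mono[OF bar_pos]) (use 3 in auto)
    moreover have "n - q \<le> m" if "suffices n ?G m" for m
      using T_tilde_lower_one[OF that n2 _ s1 q1] n 3 by simp
    ultimately show ?thesis using tilde 3 by auto
  next
    case 4
    \<comment> \<open>With \<open>2 \<le> q\<close>, leaving out Person \<open>n\<close> still
      leaves \<open>2 * s + 1\<close> people for a majority, and the remainder \<open>r - 1\<close>
      is positive.\<close>
    have "2 * (s + 1) \<le> q * (s + 1)" using 4 by (intro mult_right_mono) auto
    then have "suffices n ?G (n - 1 - q + 0)"
      by (intro skip_last[OF GF _ _ q1 _ spy_last, of "r - 1"]) (use n 4 in auto)
    then have "suffices n ?G (n - q - 1)" by (simp add: diff_right_commute)
    moreover have "n - q - 1 \<le> m" if "suffices n ?G m" for m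
      using T_tilde_lower[OF that n2, of "q + 1"] lt by simp
    ultimately show ?thesis using tilde 4 by auto
  next
    case 5
    \<comment> \<open>For \<open>q = 1\<close>, \<open>2 * s + 1 \<le> n\<close> forces
      \<open>r = s\<close>. Nobody can be left out here, and \<open>s = 2\<close> is the exceptional
      case.\<close>
    have n': "n = 2 * s + 1" using n r ns 5 by simp
    have "s \<noteq> 2" using n' k 5 by auto
    then have s3: "3 \<le> s" using 5 r by simp
    have "suffices (2 * s + 1) ?G (2 * s - 1)"
      by (rule suffices_spy_of_odd[OF s3]) (use n' in \<open>auto simp: at_most_spies_def\<close>)
    then have "suffices n ?G (n - q - 1)" using n' 5 by simp
    moreover have "n - q - 1 \<le> m" if "suffices n ?G m" for m
      using T_tilde_lower[OF that n2, of "q + 1"] lt by simp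
    ultimately show ?thesis using tilde 5 by auto
  qed
  with bar show ?thesis by blast
qed

end
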